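(* Let $a$ be an integer with $a\notin\{0,1,-1\}$, let $m$ be an even positive integer, and write $Q_{\frac m2-1}(x)=\sum_{s=0}^{m-2}c_sx^s$, where $Q_N(x)=\prod_{l=1}^{N}(x-1-a\zeta_{2N+2}^l)(x-1-a\zeta_{2N+2}^{-l})$ with $\zeta_{2N+2}=e^{2\pi i/(2N+2)}$. Then for every integer $r$ and every integer $n\geq1$, $$\sum_{s=0}^{m-2}c_s\Delta_m(r,n+s)=0.$$
   Context: For integers $n>0$, $m>0$, $r$ and $a$, let $\left[\begin{array}{c}n\\ r\end{array}\right]_m(a)=\sum_{0\le k\le n,\ k\equiv r\ (\mathrm{mod}\ m)}\binom nk a^k$. For odd $m$, $\Delta_m(r,n)=m\left[\begin{array}{c}n\\ r\end{array}\right]_m(a)-(1+a)^n$; for even $m$, $\Delta_m(r,n)=m\left[\begin{array}{c}n\\ r\end{array}\right]_m(a)-(1+a)^n-(-1)^r(1-a)^n$. *)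

theory Defs
  imports Complex_Main "HOL-Computational_Algebra.Polynomial" "HOL-Number_Theory.Cong"
begin

definition lacunary_sum :: "nat \<Rightarrow> int \<Rightarrow> nat \<Rightarrow> int \<Rightarrow> int" where
  "lacunary_sum m a n r =
     (\<Sum>k | k \<le> n \<and> [int k = r] (mod int m). int (n choose k) * a ^ k)"

text \<open>The conditional in the even case is the sign \<open>(-1)\<^sup>r\<close>, where \<open>r\<close> may be negative.\<close>

definition Delta :: "nat \<Rightarrow> int \<Rightarrow> int \<Rightarrow> nat \<Rightarrow> int" where
  "Delta m a r n =
     (if odd m then int m * lacunary_sum m a n r - (1 + a) ^ n
      else int m * lacunary_sum m a n r - (1 + a) ^ n
             - (if even r then 1 else -1) * (1 - a) ^ n)"

definition zeta :: "nat \<Rightarrow> complex" where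
  "zeta k = exp (2 * of_real pi * \<i> / of_nat k)"

definition Q :: "int \<Rightarrow> nat \<Rightarrow> complex poly" where
  "Q a N = (\<Prod>l = 1..N.
     ([:0, 1:] - [:1:] - [:of_int a * zeta (2 * N + 2) powi int l:]) *
     ([:0, 1:] - [:1:] - [:of_int a * zeta (2 * N + 2) powi (- int l):]))"

lemma degree_Q: "degree (Q a N) = 2 * N"
  unfolding Q_def by (subst degree_prod_eq_sum_degree) (auto simp: degree_mult_eq)

end

theory Submission
  imports Defs "HOL-Analysis.Complex_Transcendental"
begin

text \<open>
  Write \<open>\<zeta>\<close> for the primitive \<open>m\<close>-th root of unity. The roots-of-unity filter gives
  \<open>m [n; r]\<^sub>m(a) = \<Sum>\<^sub>j \<zeta>\<^bsup>-jr\<^esup> (1 + a \<zeta>\<^sup>j)\<^sup>n\<close> with \<open>j\<close> ranging over \<open>0, \<dots>, m - 1\<close>. The terms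
  \<open>j = 0\<close> and \<open>j = m/2\<close> are exactly what \<open>\<Delta>\<^sub>m\<close> subtracts, and every remaining base
  \<open>1 + a \<zeta>\<^sup>j\<close> is a root of \<open>Q\<close>. So \<open>\<Delta>\<^sub>m(r, n)\<close> is a linear combination of \<open>n\<close>-th powers of
  roots of \<open>Q\<close>, and such sequences satisfy the recurrence with characteristic polynomial \<open>Q\<close>.
\<close>

lemma zeta_nonzero [simp]: "zeta m \<noteq> 0"
  by (simp add: zeta_def)

lemma zeta_powi: "zeta m powi d = exp (2 * of_real pi * \<i> * of_int d / of_nat m)"
  unfolding zeta_def exp_power_int by (simp add: mult_ac)

text \<open>Primitivity of the root: \<open>exp\<close> takes the value 1 exactly at integer
  multiples of 2 pi i.\<close>

lemma zeta_powi_eq_1_iff: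
  assumes "m > 0"
  shows "zeta m powi d = 1 \<longleftrightarrow> int m dvd d"
proof -
  have "zeta m powi d = 1 \<longleftrightarrow> (\<exists>k::int. 2 * pi * of_int d / of_nat m = of_int (2 * k) * pi)"
    by (simp add: zeta_powi exp_eq_1)
  also have "\<dots> \<longleftrightarrow> (\<exists>k::int. d = int m * k)"
  proof (rule ex_cong1)
    fix k :: int
    have "2 * pi * of_int d / of_nat m = of_int (2 * k) * pi \<longleftrightarrow>
        (of_int d :: real) = of_int (int m * k)"
      using assms by (simp add: field_simps)
    also have "\<dots> \<longleftrightarrow> d = int m * k"
      by (rule of_int_eq_iff)
    finally show "2 * pi * of_int d / of_nat m = of_int (2 * k) * pi \<longleftrightarrow> d = int m * k" .
  qed
  finally show ?thesis
    by (auto simp: dvd_def)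
qed

lemma zeta_power_eq_1:
  assumes "m > 0"
  shows "zeta m ^ m = 1"
  using zeta_powi_eq_1_iff[OF assms, of "int m"] by simp

lemma zeta_power_half:
  assumes "h > 0"
  shows "zeta (2 * h) ^ h = -1"
proof -
  have "zeta (2 * h) ^ h = zeta (2 * h) powi int h"
    by simp
  also have "\<dots> = exp (of_real pi * \<i>)"
    unfolding zeta_powi using assms by (simp add: field_simps)
  finally show ?thesis
    by simp
qed

text \<open>Orthogonality of characters: unless the ratio of this geometric sum is 1, its m-th power
  is still 1, so the numerator of the closed form vanishes.\<close>

lemma sum_zeta_powi:
  assumes "m > 0"
  shows "(\<Sum>j<m. (zeta m powi d) ^ j) = (if int m dvd d then of_nat m else 0)"
proof (cases "int m dvd d")
  case True
  then have "zeta m powi d = 1"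
    using zeta_powi_eq_1_iff[OF assms] by blast
  then show ?thesis
    using True by simp
next
  case False
  have "(zeta m powi d) ^ m = zeta m powi (d * int m)"
    by (simp add: power_int_mult)
  also have "\<dots> = 1"
    by (simp add: zeta_powi_eq_1_iff[OF assms])
  finally have "(zeta m powi d) ^ m = 1" .
  moreover have "zeta m powi d \<noteq> 1"
    using False zeta_powi_eq_1_iff[OF assms] by blast
  ultimately show ?thesis
    using False by (simp add: geometric_sum)
qed

text \<open>Expanding by the binomial theorem and swapping the sums leaves, for each
  \<open>k\<close>, a sum over \<open>j\<close> that \<open>sum_zeta_powi\<close> evaluates to
  \<open>m\<close> or 0.\<close>

lemma lacunary_sum_filter:
  assumes "m > 0"
  shows "of_nat m * of_int (lacunary_sum m a n r) =
    (\<Sum>j<m. (zeta m powi (- r)) ^ j * (1 + of_int a * zeta m ^ j) ^ n)"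
proof -
  have "(\<Sum>j<m. (zeta m powi (- r)) ^ j * (1 + of_int a * zeta m ^ j) ^ n) =
      (\<Sum>j<m. \<Sum>k\<le>n. of_nat (n choose k) * of_int a ^ k * (zeta m powi (int k - r)) ^ j)"
  proof (rule sum.cong[OF refl])
    fix j
    have shift: "zeta m powi (int k - r) = zeta m powi (- r) * zeta m ^ k" for k
      using power_int_add[of "zeta m" "- r" "int k"] by simp
    have "(1 + of_int a * zeta m ^ j) ^ n =
        (\<Sum>k\<le>n. of_nat (n choose k) * (of_int a * zeta m ^ j) ^ k)"
      using binomial_ring[of "of_int a * zeta m ^ j" 1 n] by (simp add: add.commute)
    then show "(zeta m powi (- r)) ^ j * (1 + of_int a * zeta m ^ j) ^ n =
        (\<Sum>k\<le>n. of_nat (n choose k) * of_int a ^ k * (zeta m powi (int k - r)) ^ j)"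
      unfolding shift
      by (simp add: sum_distrib_left power_mult_distrib mult_ac flip: power_mult)
  qed
  also have "\<dots> = (\<Sum>k\<le>n. of_nat (n choose k) * of_int a ^ k *
      (\<Sum>j<m. (zeta m powi (int k - r)) ^ j))"
    by (subst sum.swap) (simp add: sum_distrib_left)
  also have "\<dots> = (\<Sum>k\<le>n. if [int k = r] (mod int m)
      then of_nat m * (of_nat (n choose k) * of_int a ^ k) else 0)"
    by (intro sum.cong refl) (simp add: sum_zeta_powi[OF assms] cong_iff_dvd_diff)
  also have "\<dots> = (\<Sum>k | k \<le> n \<and> [int k = r] (mod int m).
      of_nat m * (of_nat (n choose k) * of_int a ^ k))"
    by (subst sum.inter_filter[symmetric]) simp_all
  also have "\<dots> = of_nat m * of_int (lacunary_sum m a n r)"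
    by (simp add: lacunary_sum_def sum_distrib_left)
  finally show ?thesis
    by simp
qed

lemma Delta_even_eq_sum:
  assumes "h > 0"
  shows "of_int (Delta (2 * h) a r n) =
    (\<Sum>j\<in>{..<2 * h} - {0, h}.
      (zeta (2 * h) powi (- r)) ^ j * (1 + of_int a * zeta (2 * h) ^ j) ^ n)"
proof -
  let ?f = "\<lambda>j. (zeta (2 * h) powi (- r)) ^ j * (1 + of_int a * zeta (2 * h) ^ j) ^ n"
  \<comment> \<open>Exchanging the exponents reduces the weight at \<open>j = h\<close> to a power
    of -1, which also covers negative \<open>r\<close>.\<close>
  have "(zeta (2 * h) powi (- r)) ^ h = zeta (2 * h) powi (- r * int h)"
    by (simp only: power_int_mult power_int_of_nat)
  also have "\<dots> = (zeta (2 * h) ^ h) powi (- r)"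
    by (metis mult.commute power_int_mult power_int_of_nat)
  also have "\<dots> = (if even r then 1 else -1)"
    using zeta_power_half[OF assms] by simp
  finally have mid: "?f h = (if even r then 1 else -1) * (1 - of_int a) ^ n"
    using zeta_power_half[OF assms] by simp
  have "sum ?f {..<2 * h} = sum ?f ({..<2 * h} - {0, h}) + sum ?f {0, h}"
    using assms by (intro sum.subset_diff) auto
  also have "sum ?f {0, h} = (1 + of_int a) ^ n + ?f h"
    using assms by simp
  finally have "of_nat (2 * h) * of_int (lacunary_sum (2 * h) a n r) =
      sum ?f ({..<2 * h} - {0, h}) + ((1 + of_int a) ^ n + ?f h)"
    using lacunary_sum_filter[of "2 * h" a n r] assms by simp
  then show ?thesis
    unfolding mid by (simp add: Delta_def split: if_splits)
qed

lemma poly_Q_root: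
  assumes "j \<in> {..<2 * h} - {0, h}"
  shows "poly (Q a (h - 1)) (1 + of_int a * zeta (2 * h) ^ j) = 0"
proof -
  \<comment> \<open>The index set is empty for \<open>h = 0\<close>, so the truncated subtraction is
    harmless and the root in \<open>Q\<close> is \<open>zeta (2 * h)\<close>.\<close>
  have h: "2 * (h - 1) + 2 = 2 * h" "h > 0"
    using assms by auto
  have "\<exists>l\<in>{1..h - 1}. zeta (2 * h) ^ j = zeta (2 * h) powi int l \<or>
      zeta (2 * h) ^ j = zeta (2 * h) powi (- int l)"
  proof (cases "j < h")
    case True
    then show ?thesis
      using assms by (intro bexI[of _ j]) auto
  next
    case False
    \<comment> \<open>For \<open>j > h\<close> the witness is \<open>l = 2 * h - j\<close>: the
      exponents \<open>j\<close> and \<open>-l\<close> differ by the full period.\<close>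
    have "zeta (2 * h) powi (- int (2 * h - j)) = zeta (2 * h) powi (int j - int (2 * h))"
      using assms by (simp add: of_nat_diff)
    also have "\<dots> = zeta (2 * h) ^ j / zeta (2 * h) ^ (2 * h)"
      by (metis power_int_diff power_int_of_nat zeta_nonzero)
    also have "\<dots> = zeta (2 * h) ^ j"
      using h by (simp add: zeta_power_eq_1)
    finally show ?thesis
      using assms False by (intro bexI[of _ "2 * h - j"]) auto
  qed
  then obtain l where l: "l \<in> {1..h - 1}"
    "zeta (2 * h) ^ j = zeta (2 * h) powi int l \<or> zeta (2 * h) ^ j = zeta (2 * h) powi (- int l)"
    by blast
  show ?thesis
    unfolding Q_def h(1) poly_prod
  proof (rule prod_zero[OF finite_atLeastAtMost bexI[OF _ l(1)]])
    show "poly (([:0, 1:] - [:1:] - [:of_int a * zeta (2 * h) powi int l:]) *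
        ([:0, 1:] - [:1:] - [:of_int a * zeta (2 * h) powi (- int l):]))
        (1 + of_int a * zeta (2 * h) ^ j) = 0"
      unfolding poly_mult mult_eq_0_iff using l(2) by auto
  qed
qed

text \<open>At a root of \<open>p\<close> the right side is 0, so the powers of that root satisfy
  the recurrence with characteristic polynomial \<open>p\<close>.\<close>

lemma sum_coeff_mult_power_shift:
  fixes p :: "'a::comm_semiring_1 poly"
  assumes "degree p \<le> d"
  shows "(\<Sum>s\<le>d. coeff p s * x ^ (n + s)) = x ^ n * poly p x"
proof -
  have "poly p x = (\<Sum>s\<le>d. coeff p s * x ^ s)"
    unfolding poly_altdef using assms
    by (intro sum.mono_neutral_left) (auto simp: coeff_eq_0)
  then show ?thesis
    by (simp add: sum_distrib_left power_add mult_ac)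
qed

theorem theorem3p7:
  fixes a r :: int and m n :: nat
  assumes "a \<notin> {0, 1, -1}" and "even m" and "m > 0" and "n \<ge> 1"
  shows "(\<Sum>s = 0..m - 2. coeff (Q a (m div 2 - 1)) s * of_int (Delta m a r (n + s))) = 0"
proof -
  obtain h where m: "m = 2 * h" and h: "h > 0"
    using assms(2,3) by auto
  let ?q = "Q a (h - 1)" and ?J = "{..<2 * h} - {0, h}"
  let ?x = "\<lambda>j. 1 + of_int a * zeta (2 * h) ^ j"
  have "(\<Sum>s\<le>2 * h - 2. coeff ?q s * of_int (Delta (2 * h) a r (n + s))) =
      (\<Sum>s\<le>2 * h - 2. \<Sum>j\<in>?J.
        (zeta (2 * h) powi (- r)) ^ j * (coeff ?q s * ?x j ^ (n + s)))"
    unfolding Delta_even_eq_sum[OF h] sum_distrib_left by (simp add: mult_ac)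
  also have "\<dots> = (\<Sum>j\<in>?J. (zeta (2 * h) powi (- r)) ^ j *
      (\<Sum>s\<le>2 * h - 2. coeff ?q s * ?x j ^ (n + s)))"
    by (subst sum.swap) (simp only: sum_distrib_left)
  \<comment> \<open>The degree of \<open>?q\<close> is \<open>2 * (h - 1)\<close>, so the range of
    \<open>s\<close> reaches every coefficient.\<close>
  also have "\<dots> = (\<Sum>j\<in>?J. (zeta (2 * h) powi (- r)) ^ j * (?x j ^ n * poly ?q (?x j)))"
    by (subst sum_coeff_mult_power_shift) (simp_all add: degree_Q)
  also have "\<dots> = 0"
    by (intro sum.neutral ballI) (simp only: poly_Q_root mult_zero_right)
  finally show ?thesis
    by (simp add: m atMost_atLeast0)
qed

end
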